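(* Let $(\sigma_1,\ldots,\sigma_{2^D})$ be any enumeration (permutation) of $\{0,1\}^D$, and for each $j\in\mathbb N[M]$ let $H_j:=\overline\omega(T^{\rm b}_j)-\underline\omega(T^{\rm b}_j)\in\mathbb R^D$. For every $\alpha\in\mathbb R^{G\times D}$ and $\beta_{1:M}=(\beta_1,\ldots,\beta_M)$ with $\beta_j\in\mathbb R^G$, the condition $$A\,\hat x_{\alpha,\beta_{1:M}}(\xi,t)+B\,\xi(t)\le a\quad\forall(\xi,t)\in\Omega\times\mathcal T$$ holds if and only if $$(A\alpha+B)\left(\underline\omega(T^{\rm b}_j)+\sigma_l\circ H_j\right)+A\beta_j\le a\quad\forall(j,l)\in\mathbb N[M]\times\mathbb N[2^D].$$
   Context: Notation: $\mathbb N[n]:=\{1,\ldots,n\}$; $\circ$ is the entrywise product of vectors; vector inequalities are entrywise; $G,D,L$ are positive integers (numbers of generators, loads, transmission lines); $T\in(0,\infty)$, $\mathcal T:=[0,T]$; $\mathcal C_n$ is the set of continuous functions $\mathcal T\to\mathbb R^n$; $\mathcal T^{\rm o}:=\{(t_1,t_2)\in\mathcal T^2:t_1<t_2\}$. Constraint data: $\overline X,\underline X\in\mathbb R^G_+$, $\overline F\in\mathbb R^L_+$, $F^{\rm g}\in\mathbb R^{L\times G}$, $F^{\rm d}\in\mathbb R^{L\times D}$. The matrices $A\in\mathbb R^{2(G+L)\times G}$, $B\in\mathbb R^{2(G+L)\times D}$ and vector $a\in\mathbb R^{2(G+L)}$ are such that $Ax+B\zeta\le a$ encodes $\underline X\le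 x\le\overline X$ and $-\overline F\le F^{\rm g}x+F^{\rm d}\zeta\le\overline F$; that is, up to ordering of rows, $A$ stacks $I,-I,F^{\rm g},-F^{\rm g}$; $B$ stacks $0,0,F^{\rm d},-F^{\rm d}$; and $a$ stacks $\overline X,-\underline X,\overline F,\overline F$. Demand data: for each $d\in\mathbb N[D]$, $\Xi_d$ is a given set, with at least two elements, of functions $\xi_d:\mathcal T\to\mathbb R$. With $R(\xi_d,t_1,t_2):=(\xi_d(t_2)-\xi_d(t_1))/(t_2-t_1)$, it is assumed that $\overline r_d:=\sup\{R(\xi_d,t_1,t_2):\xi_d\in\Xi_d,(t_1,t_2)\in\mathcal T^{\rm o}\}<\infty$ and $\underline r_d:=\inf\{R(\xi_d,t_1,t_2):\xi_d\in\Xi_d,(t_1,t_2)\in\mathcal T^{\rm o}\}>-\infty$. Superset $\Omega$: fix an integer $N\ge2$ and equally spaced points $0=T_1<T_2<\cdots<T_N=T$. Let $i(t):=j$ if $t\in[T_j,T_{j+1})$ and $i(T):=N-1$. Let $\overline\omega'_d(t):=\sup\{\xi_d(\tau):\xi_d\in\Xi_d,\tau\in[T_{i(t)},T_{i(t)+1}]\}$ and $\underline\omega'_d(t):=\inf\{\xi_d(\tau):\xi_d\in\Xi_d,\tau\in[T_{i(t)},T_{i(t)+1}]\}$, assumed finite. Let $$\Omega_d:=\{\xi_d\in\mathcal C_1:\underline\omega'_d(t)\le\xi_d(t)\le\overline\omega'_d(t)\ \forall t\in\mathcal T,\ \underline r_d\le R(\xi_d,t_1,t_2)\le\overline r_d\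 \forall(t_1,t_2)\in\mathcal T^{\rm o}\},\quad \Omega:=\Omega_1\times\cdots\times\Omega_D\subset\mathcal C_D.$$ Envelopes $\overline\omega_d,\underline\omega_d\in\mathcal C_1$: each is the continuous piecewise affine function determined by its breakpoints and its values there (convention $0/0=0$). For $j\in\mathbb N[N-2]$ let $\overline\omega'^{+}_{d,j}:=\overline\omega'_d(T_{j+1})-\overline\omega'_d(T_j)$ and $\underline\omega'^{+}_{d,j}:=\underline\omega'_d(T_{j+1})-\underline\omega'_d(T_j)$. Breakpoints of $\overline\omega_d$: $\overline{\mathcal T}^{\rm b}_d:=\{T_1,\ldots,T_N\}\cup\{\overline T^{\rm b}_{d,1},\ldots,\overline T^{\rm b}_{d,N-2}\}$, where $\overline T^{\rm b}_{d,j}:=T_{j+1}+\overline\omega'^{+}_{d,j}/\overline r_d$ if $\overline\omega'^{+}_{d,j}\ge0$, and $T_{j+1}-\overline\omega'^{+}_{d,j}/\underline r_d$ otherwise. Values: $\overline\omega_d(T_1):=\overline\omega'_d(T_1)$; $\overline\omega_d(T_{j+1}):=\min\{\overline\omega'_d(T_j),\overline\omega'_d(T_{j+1})\}$ for $j\in\mathbb N[N-1]$; $\overline\omega_d(\overline T^{\rm b}_{d,j}):=\max\{\overline\omega'_d(T_j),\overline\omega'_d(T_{j+1})\}$ for $j\in\mathbb N[N-2]$. Breakpoints of $\underline\omega_d$: $\underline{\mathcal T}^{\rm b}_d:=\{T_1,\ldots,T_N\}\cup\{\underline T^{\rm b}_{d,1},\ldots,\underline T^{\rm b}_{d,N-2}\}$,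 where $\underline T^{\rm b}_{d,j}:=T_{j+1}-\underline\omega'^{+}_{d,j}/\overline r_d$ if $\underline\omega'^{+}_{d,j}\ge0$, and $T_{j+1}+\underline\omega'^{+}_{d,j}/\underline r_d$ otherwise. Values: $\underline\omega_d(T_1):=\underline\omega'_d(T_1)$; $\underline\omega_d(T_{j+1}):=\max\{\underline\omega'_d(T_j),\underline\omega'_d(T_{j+1})\}$ for $j\in\mathbb N[N-1]$; $\underline\omega_d(\underline T^{\rm b}_{d,j}):=\min\{\underline\omega'_d(T_j),\underline\omega'_d(T_{j+1})\}$ for $j\in\mathbb N[N-2]$. Put $\overline\omega(t):=(\overline\omega_1(t),\ldots,\overline\omega_D(t))$, $\underline\omega(t):=(\underline\omega_1(t),\ldots,\underline\omega_D(t))$. Standing property of the setting: $\overline\omega_d$ and $\underline\omega_d$ belong to $\Omega_d$ and are its pointwise largest and smallest elements, and $\{\xi_d(t):\xi_d\in\Omega_d\}=[\underline\omega_d(t),\overline\omega_d(t)]$ for all $t\in\mathcal T$. Decision rule: let $\mathcal T^{\rm b}:=\bigcup_{d\in\mathbb N[D]}(\overline{\mathcal T}^{\rm b}_d\cup\underline{\mathcal T}^{\rm b}_d)=\{T^{\rm b}_1,\ldots,T^{\rm b}_M\}$ with $0=T^{\rm b}_1<\cdots<T^{\rm b}_M=T$, $M=|\mathcal T^{\rm b}|$, and $\Delta^{\rm b}_j:=T^{\rm b}_{j+1}-T^{\rm b}_j$. Let $k(t):=j$ if $t\in[T^{\rm b}_j,T^{\rm b}_{j+1})$, $k(T):=M-1$;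 $\gamma(t):=(t-T^{\rm b}_{k(t)})/\Delta^{\rm b}_{k(t)}$ for $t\in[0,T)$, $\gamma(T):=1$. For $\alpha\in\mathbb R^{G\times D}$ and $\beta_1,\ldots,\beta_M\in\mathbb R^G$, and $\xi\in\Omega$, $t\in\mathcal T$, $$\hat x_{\alpha,\beta_{1:M}}(\xi,t):=\alpha\xi(t)+(1-\gamma(t))\beta_{k(t)}+\gamma(t)\beta_{k(t)+1}\in\mathbb R^G.$$ *)

theory Defs
  imports "HOL-Analysis.Analysis"
begin

text \<open>
  Generators, loads and transmission lines are the elements of finite types \<open>'g\<close>, \<open>'d\<close>, \<open>'l\<close>.
  A function on \<open>\<T> = {0..T}\<close> is represented by a function on \<open>real\<close> of which only
  the values on \<open>{0..T}\<close> matter. Inequalities and products of vectors are the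
  entrywise ones of the library.
\<close>

text \<open>
  The \<open>2(G + L)\<close> rows are indexed by a sum type; the four summands are the blocks
  \<open>x \<le> Xmax\<close>, \<open>Xmin \<le> x\<close>, \<open>Fg x + Fd \<zeta> \<le> Fmax\<close>, \<open>- Fmax \<le> Fg x + Fd \<zeta>\<close>.
\<close>

definition con_A :: "real^'g^'l \<Rightarrow> real^'g^('g + 'g + 'l + 'l)" where
  "con_A Fg = (\<chi> r. case r of
      Inl g \<Rightarrow> row g (mat 1)
    | Inr (Inl g) \<Rightarrow> - row g (mat 1)
    | Inr (Inr (Inl l)) \<Rightarrow> row l Fg
    | Inr (Inr (Inr l)) \<Rightarrow> - row l Fg)"

definition con_B :: "real^'d^'l \<Rightarrow> real^'d^('g::finite + 'g + 'l + 'l)" where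
  "con_B Fd = (\<chi> r. case r of
      Inl g \<Rightarrow> 0
    | Inr (Inl g) \<Rightarrow> 0
    | Inr (Inr (Inl l)) \<Rightarrow> row l Fd
    | Inr (Inr (Inr l)) \<Rightarrow> - row l Fd)"

definition con_a :: "real^'g \<Rightarrow> real^'g \<Rightarrow> real^'l \<Rightarrow> real^('g + 'g + 'l + 'l)" where
  "con_a Xmax Xmin Fmax = (\<chi> r. case r of
      Inl g \<Rightarrow> Xmax $ g
    | Inr (Inl g) \<Rightarrow> - Xmin $ g
    | Inr (Inr (Inl l)) \<Rightarrow> Fmax $ l
    | Inr (Inr (Inr l)) \<Rightarrow> Fmax $ l)"

lemma constraint_encoding:
  fixes x :: "real^'g" and \<zeta> :: "real^'d" and Fg :: "real^'g^'l"
  shows "con_A Fg *v x + con_B Fd *v \<zeta> \<le> con_a Xmax Xmin Fmax \<longleftrightarrow>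
    Xmin \<le> x \<and> x \<le> Xmax \<and> - Fmax \<le> Fg *v x + Fd *v \<zeta> \<and> Fg *v x + Fd *v \<zeta> \<le> Fmax"
proof -
  have split: "(\<forall>r. P r) \<longleftrightarrow> (\<forall>g. P (Inl g)) \<and> (\<forall>g. P (Inr (Inl g))) \<and>
      (\<forall>l. P (Inr (Inr (Inl l)))) \<and> (\<forall>l. P (Inr (Inr (Inr l))))"
    for P :: "'g + 'g + 'l + 'l \<Rightarrow> bool"
    by (metis sum.exhaust)
  have delta: "(\<Sum>j\<in>UNIV. (if g = j then 1 else 0) * x $ j) = x $ g" for g
    by (simp add: if_distrib if_distribR cong: if_cong)
  have neg: "- u \<le> v + w \<longleftrightarrow> - v - w \<le> u" for u v w :: real
    by linarith
  show ?thesis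
    unfolding less_eq_vec_def split
    by (auto simp: con_A_def con_B_def con_a_def matrix_vector_mult_def row_def mat_def
        delta sum_negf neg)
qed

definition grid :: "real \<Rightarrow> nat \<Rightarrow> nat \<Rightarrow> real" where
  "grid T N j = (real j - 1) * T / (real N - 1)"

text \<open>
  For points \<open>p 1 < \<dots> < p n\<close>: the index of the segment containing \<open>t\<close>, the last
  segment being closed on the right.
\<close>

definition seg_index :: "(nat \<Rightarrow> real) \<Rightarrow> nat \<Rightarrow> real \<Rightarrow> nat" where
  "seg_index p n t =
    (if t = p n then n - 1 else (THE j. j \<in> {1..n-1} \<and> t \<in> {p j..<p (j+1)}))"

definition time_pairs :: "real \<Rightarrow> (real \<times> real) set" where
  "time_pairs T = {(t1, t2). t1 \<in> {0..T} \<and> t2 \<in> {0..T} \<and> t1 < t2}"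

definition rate :: "(real \<Rightarrow> real) \<Rightarrow> real \<Rightarrow> real \<Rightarrow> real" where
  "rate \<xi> t1 t2 = (\<xi> t2 - \<xi> t1) / (t2 - t1)"

definition rates :: "real \<Rightarrow> (real \<Rightarrow> real) set \<Rightarrow> real set" where
  "rates T X = {rate \<xi> t1 t2 | \<xi> t1 t2. \<xi> \<in> X \<and> (t1, t2) \<in> time_pairs T}"

definition rmax :: "real \<Rightarrow> (real \<Rightarrow> real) set \<Rightarrow> real" where
  "rmax T X = Sup (rates T X)"

definition rmin :: "real \<Rightarrow> (real \<Rightarrow> real) set \<Rightarrow> real" where
  "rmin T X = Inf (rates T X)"

definition window_values :: "real \<Rightarrow> nat \<Rightarrow> (real \<Rightarrow> real) set \<Rightarrow> real \<Rightarrow> real set" where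
  "window_values T N X t = {\<xi> \<tau> | \<xi> \<tau>. \<xi> \<in> X \<and>
     \<tau> \<in> {grid T N (seg_index (grid T N) N t)..grid T N (seg_index (grid T N) N t + 1)}}"

definition window_sup :: "real \<Rightarrow> nat \<Rightarrow> (real \<Rightarrow> real) set \<Rightarrow> real \<Rightarrow> real" where
  "window_sup T N X t = Sup (window_values T N X t)"

definition window_inf :: "real \<Rightarrow> nat \<Rightarrow> (real \<Rightarrow> real) set \<Rightarrow> real \<Rightarrow> real" where
  "window_inf T N X t = Inf (window_values T N X t)"

definition Omega_comp :: "real \<Rightarrow> nat \<Rightarrow> (real \<Rightarrow> real) set \<Rightarrow> (real \<Rightarrow> real) set" where
  "Omega_comp T N X = {\<xi>. continuous_on {0..T} \<xi> \<and>
     (\<forall>t\<in>{0..T}. window_inf T N X t \<le> \<xi> t \<and> \<xi> t \<le> window_sup T N X t) \<and>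
     (\<forall>(t1, t2)\<in>time_pairs T. rmin T X \<le> rate \<xi> t1 t2 \<and> rate \<xi> t1 t2 \<le> rmax T X)}"

definition Omega :: "real \<Rightarrow> nat \<Rightarrow> ('d \<Rightarrow> (real \<Rightarrow> real) set) \<Rightarrow> (real \<Rightarrow> real^'d) set" where
  "Omega T N \<Xi> = {\<xi>. \<forall>d. (\<lambda>t. \<xi> t $ d) \<in> Omega_comp T N (\<Xi> d)}"

definition upper_jump :: "real \<Rightarrow> nat \<Rightarrow> (real \<Rightarrow> real) set \<Rightarrow> nat \<Rightarrow> real" where
  "upper_jump T N X j = window_sup T N X (grid T N (j+1)) - window_sup T N X (grid T N j)"

definition lower_jump :: "real \<Rightarrow> nat \<Rightarrow> (real \<Rightarrow> real) set \<Rightarrow> nat \<Rightarrow> real" where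
  "lower_jump T N X j = window_inf T N X (grid T N (j+1)) - window_inf T N X (grid T N j)"

definition upper_bp :: "real \<Rightarrow> nat \<Rightarrow> (real \<Rightarrow> real) set \<Rightarrow> nat \<Rightarrow> real" where
  "upper_bp T N X j =
    (if upper_jump T N X j \<ge> 0 then grid T N (j+1) + upper_jump T N X j / rmax T X
     else grid T N (j+1) - upper_jump T N X j / rmin T X)"

definition lower_bp :: "real \<Rightarrow> nat \<Rightarrow> (real \<Rightarrow> real) set \<Rightarrow> nat \<Rightarrow> real" where
  "lower_bp T N X j =
    (if lower_jump T N X j \<ge> 0 then grid T N (j+1) - lower_jump T N X j / rmax T X
     else grid T N (j+1) + lower_jump T N X j / rmin T X)"

definition upper_bps :: "real \<Rightarrow> nat \<Rightarrow> (real \<Rightarrow> real) set \<Rightarrow> real set" where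
  "upper_bps T N X = grid T N ` {1..N} \<union> upper_bp T N X ` {1..N-2}"

definition lower_bps :: "real \<Rightarrow> nat \<Rightarrow> (real \<Rightarrow> real) set \<Rightarrow> real set" where
  "lower_bps T N X = grid T N ` {1..N} \<union> lower_bp T N X ` {1..N-2}"

definition affine_between :: "real set \<Rightarrow> (real \<Rightarrow> real) \<Rightarrow> bool" where
  "affine_between P f \<longleftrightarrow> (\<forall>a\<in>P. \<forall>b\<in>P. a < b \<and> P \<inter> {a<..<b} = {} \<longrightarrow>
     (\<exists>m c. \<forall>t\<in>{a..b}. f t = m * t + c))"

text \<open>
  The envelopes are specified by the properties that determine them uniquely on
  \<open>{0..T}\<close>. Breakpoints with different indices may coincide, and then all the value
  equations are imposed.
\<close>

definition is_upper_envelope ::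
  "real \<Rightarrow> nat \<Rightarrow> (real \<Rightarrow> real) set \<Rightarrow> (real \<Rightarrow> real) \<Rightarrow> bool" where
  "is_upper_envelope T N X w \<longleftrightarrow>
     continuous_on {0..T} w \<and> affine_between (upper_bps T N X) w \<and>
     w (grid T N 1) = window_sup T N X (grid T N 1) \<and>
     (\<forall>j\<in>{1..N-1}. w (grid T N (j+1)) =
        min (window_sup T N X (grid T N j)) (window_sup T N X (grid T N (j+1)))) \<and>
     (\<forall>j\<in>{1..N-2}. w (upper_bp T N X j) =
        max (window_sup T N X (grid T N j)) (window_sup T N X (grid T N (j+1))))"

definition is_lower_envelope ::
  "real \<Rightarrow> nat \<Rightarrow> (real \<Rightarrow> real) set \<Rightarrow> (real \<Rightarrow> real) \<Rightarrow> bool" where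
  "is_lower_envelope T N X w \<longleftrightarrow>
     continuous_on {0..T} w \<and> affine_between (lower_bps T N X) w \<and>
     w (grid T N 1) = window_inf T N X (grid T N 1) \<and>
     (\<forall>j\<in>{1..N-1}. w (grid T N (j+1)) =
        max (window_inf T N X (grid T N j)) (window_inf T N X (grid T N (j+1)))) \<and>
     (\<forall>j\<in>{1..N-2}. w (lower_bp T N X j) =
        min (window_inf T N X (grid T N j)) (window_inf T N X (grid T N (j+1))))"

definition all_bps :: "real \<Rightarrow> nat \<Rightarrow> ('d::finite \<Rightarrow> (real \<Rightarrow> real) set) \<Rightarrow> real set" where
  "all_bps T N \<Xi> = (\<Union>d. upper_bps T N (\<Xi> d) \<union> lower_bps T N (\<Xi> d))"

definition num_bps :: "real \<Rightarrow> nat \<Rightarrow> ('d::finite \<Rightarrow> (real \<Rightarrow> real) set) \<Rightarrow> nat" where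
  "num_bps T N \<Xi> = card (all_bps T N \<Xi>)"

definition Tb :: "real \<Rightarrow> nat \<Rightarrow> ('d::finite \<Rightarrow> (real \<Rightarrow> real) set) \<Rightarrow> nat \<Rightarrow> real" where
  "Tb T N \<Xi> j = sorted_list_of_set (all_bps T N \<Xi>) ! (j - 1)"

definition k_index :: "real \<Rightarrow> nat \<Rightarrow> ('d::finite \<Rightarrow> (real \<Rightarrow> real) set) \<Rightarrow> real \<Rightarrow> nat" where
  "k_index T N \<Xi> = seg_index (Tb T N \<Xi>) (num_bps T N \<Xi>)"

definition \<gamma> :: "real \<Rightarrow> nat \<Rightarrow> ('d::finite \<Rightarrow> (real \<Rightarrow> real) set) \<Rightarrow> real \<Rightarrow> real" where
  "\<gamma> T N \<Xi> t = (if t = T then 1 else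
     (t - Tb T N \<Xi> (k_index T N \<Xi> t)) /
     (Tb T N \<Xi> (k_index T N \<Xi> t + 1) - Tb T N \<Xi> (k_index T N \<Xi> t)))"

definition x_hat :: "real \<Rightarrow> nat \<Rightarrow> ('d::finite \<Rightarrow> (real \<Rightarrow> real) set) \<Rightarrow>
    real^'d^'g \<Rightarrow> (nat \<Rightarrow> real^'g) \<Rightarrow> (real \<Rightarrow> real^'d) \<Rightarrow> real \<Rightarrow> real^'g" where
  "x_hat T N \<Xi> \<alpha> \<beta> \<xi> t = \<alpha> *v \<xi> t
     + (1 - \<gamma> T N \<Xi> t) *\<^sub>R \<beta> (k_index T N \<Xi> t)
     + \<gamma> T N \<Xi> t *\<^sub>R \<beta> (k_index T N \<Xi> t + 1)"

end

theory Submission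
  imports Defs
begin

text \<open>
  Between two consecutive breakpoints both envelopes and the interpolated offsets \<open>\<beta>\<close> are affine in
  time. Fix one row of the constraint system. For a given time, its left-hand side is an affine
  function of the demand vector, so over the box between the two envelopes it is largest at a
  vertex, and which vertex that is depends only on the signs of the coefficients of the row, not on
  the time. Along this vertex the left-hand side is affine in time on every segment between
  consecutive breakpoints (\<open>affine_on_between_refinement\<close>); it therefore stays below the bound on the
  segment as soon as it does so at the two ends. This gives the robust constraint from the finitely
  many vertex constraints. Conversely, every vertex of the box is the value of an element of \<open>\<Omega>\<close>,
  since \<open>\<Omega>\<close> is a product and contains each combination of the upper and lower envelopes; at a
  breakpoint the interpolation returns \<open>\<beta>\<close> at that breakpoint.

  What remains is that the breakpoints really form a partition of the horizon
  (\<open>all_bps_subset_horizon\<close>). An auxiliary breakpoint is displaced from a grid point by a jump of the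
  window bound divided by an extremal rate. Adjacent windows share a grid point, and every demand
  trajectory can leave its value there with at most the extremal rate, so the displacement never
  exceeds one grid step (\<open>jump_bounds\<close>).
\<close>

section \<open>Locating a time in a partition\<close>

lemma seg_index_eq:
  assumes mono: "strict_mono_on {1..n} p" and j: "j \<in> {1..n-1}" and t: "t \<in> {p j..<p (j+1)}"
  shows "seg_index p n t = j"
proof -
  have le: "p a \<le> p b" if "a \<le> b" "1 \<le> a" "b \<le> n" for a b
    using strict_mono_on_leD[OF mono, of a b] that by auto
  have "t < p n"
    using t j le[of "j+1" n] by fastforce
  moreover have "(THE j. j \<in> {1..n-1} \<and> t \<in> {p j..<p (j+1)}) = j"
  proof (rule the_equality)
    fix i assume i: "i \<in> {1..n-1} \<and> t \<in> {p i..<p (i+1)}"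
    have n: "i \<le> n" "j \<le> n" using i j by auto
    have "\<not> i < j" using le[of "i+1" j] i n t by auto
    moreover have "\<not> j < i" using le[of "j+1" i] j i n t by auto
    ultimately show "i = j" by simp
  qed (use j t in auto)
  ultimately show ?thesis by (simp add: seg_index_def)
qed

lemma seg_index_bracket:
  assumes mono: "strict_mono_on {1..n} p" and n: "n \<ge> 2" and t: "t \<in> {p 1..p n}"
  shows "seg_index p n t \<in> {1..n-1}"
    and "p (seg_index p n t) \<le> t" and "t \<le> p (seg_index p n t + 1)"
proof -
  have "seg_index p n t \<in> {1..n-1} \<and> p (seg_index p n t) \<le> t \<and> t \<le> p (seg_index p n t + 1)"
  proof (cases "t = p n")
    case True
    have "p (n-1) \<le> p n"
      using strict_mono_on_leD[OF mono, of "n-1" n] n by auto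
    with True n show ?thesis by (simp add: seg_index_def)
  next
    case False
    define J where "J = {i \<in> {1..n-1}. p i \<le> t}"
    have fin: "finite J" and "1 \<in> J" using n t by (auto simp: J_def)
    define j where "j = Max J"
    have jJ: "j \<in> J" unfolding j_def using fin \<open>1 \<in> J\<close> by (intro Max_in) auto
    have "t < p (j+1)"
    proof (cases "j + 1 = n")
      case True with False t show ?thesis by auto
    next
      case neq: False
      have "j + 1 \<notin> J" using Max_ge[OF fin, of "j+1"] by (auto simp: j_def)
      with neq jJ show ?thesis by (auto simp: J_def)
    qed
    with jJ seg_index_eq[OF mono, of j t] show ?thesis by (auto simp: J_def)
  qed
  then show "seg_index p n t \<in> {1..n-1}"
    and "p (seg_index p n t) \<le> t" and "t \<le> p (seg_index p n t + 1)" by auto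
qed

lemma grid_strict_mono:
  assumes "T > 0" "N \<ge> 2"
  shows "strict_mono_on {1..N} (grid T N)"
proof (rule strict_mono_onI)
  fix r s :: nat assume "r < s"
  with assms show "grid T N r < grid T N s"
    by (simp add: grid_def divide_strict_right_mono)
qed

lemma grid_ends:
  assumes "N \<ge> 2"
  shows "grid T N 1 = 0" "grid T N N = T"
  using assms by (auto simp: grid_def)

lemma grid_Suc: "grid T N (j+1) = grid T N j + T / (real N - 1)"
  by (simp add: grid_def add_divide_distrib[symmetric]) (simp add: algebra_simps)

lemma grid_in_horizon:
  assumes "T > 0" "N \<ge> 2" "j \<in> {1..N}"
  shows "grid T N j \<in> {0..T}"
proof -
  have "grid T N 1 \<le> grid T N j" "grid T N j \<le> grid T N N"
    using strict_mono_on_leD[OF grid_strict_mono[OF assms(1,2)]] assms by auto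
  then show ?thesis using grid_ends[OF assms(2)] by simp
qed

section \<open>Breakpoints stay in the horizon\<close>

lemma increment_bounds:
  assumes bdd: "bdd_above (rates T X)" "bdd_below (rates T X)"
    and "\<xi> \<in> X" "0 \<le> s" "s \<le> t" "t \<le> T" "t - s \<le> h"
  shows "\<xi> t - \<xi> s \<le> max 0 (rmax T X * h)" "min 0 (rmin T X * h) \<le> \<xi> t - \<xi> s"
proof -
  have "\<xi> t - \<xi> s \<le> max 0 (rmax T X * h) \<and> min 0 (rmin T X * h) \<le> \<xi> t - \<xi> s"
  proof (cases "s = t")
    case False
    with assms have st: "s < t" by simp
    have "rate \<xi> s t \<in> rates T X"
      using assms st unfolding rates_def time_pairs_def by fastforce
    then have "rate \<xi> s t \<le> rmax T X" "rmin T X \<le> rate \<xi> s t"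
      using bdd by (auto simp: rmax_def rmin_def intro: cSup_upper cInf_lower)
    then have "\<xi> t - \<xi> s \<le> rmax T X * (t - s)" "rmin T X * (t - s) \<le> \<xi> t - \<xi> s"
      using st by (simp_all add: rate_def pos_divide_le_eq pos_le_divide_eq)
    moreover have "rmax T X * (t - s) \<le> max 0 (rmax T X * h)"
    proof (cases "rmax T X \<ge> 0")
      case True
      then show ?thesis using mult_left_mono[OF assms(7) True] by simp
    next
      case False
      then have "rmax T X * (t - s) \<le> 0" using st by (simp add: mult_nonpos_nonneg)
      then show ?thesis by simp
    qed
    moreover have "min 0 (rmin T X * h) \<le> rmin T X * (t - s)"
    proof (cases "rmin T X \<ge> 0")
      case True
      then have "0 \<le> rmin T X * (t - s)" using st by simp
      then show ?thesis by simp
    next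
      case False
      then show ?thesis using mult_left_mono_neg[OF assms(7), of "rmin T X"] by linarith
    qed
    ultimately show ?thesis by linarith
  qed simp
  then show "\<xi> t - \<xi> s \<le> max 0 (rmax T X * h)" "min 0 (rmin T X * h) \<le> \<xi> t - \<xi> s" by auto
qed

lemma window_values_grid:
  assumes "T > 0" "N \<ge> 2" "j \<in> {1..N-1}"
  shows "window_values T N X (grid T N j) =
    {\<xi> \<tau> | \<xi> \<tau>. \<xi> \<in> X \<and> \<tau> \<in> {grid T N j..grid T N (j+1)}}"
proof -
  have "grid T N j < grid T N (j+1)"
    using strict_mono_onD[OF grid_strict_mono[OF assms(1,2)], of j "j+1"] assms by auto
  then have "seg_index (grid T N) N (grid T N j) = j"
    using seg_index_eq[OF grid_strict_mono[OF assms(1,2)] assms(3)] by simp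
  then show ?thesis by (simp add: window_values_def)
qed

lemma Sup_le_Sup_plus:
  fixes c :: real
  assumes "V \<noteq> {}" "bdd_above U" "\<And>v. v \<in> V \<Longrightarrow> \<exists>u\<in>U. v \<le> u + c"
  shows "Sup V \<le> Sup U + c"
proof (rule cSup_least[OF assms(1)])
  fix v assume "v \<in> V"
  then obtain u where "u \<in> U" "v \<le> u + c" using assms(3) by blast
  with cSup_upper[OF \<open>u \<in> U\<close> assms(2)] show "v \<le> Sup U + c" by simp
qed

lemma Inf_minus_le_Inf:
  fixes c :: real
  assumes "V \<noteq> {}" "bdd_below U" "\<And>v. v \<in> V \<Longrightarrow> \<exists>u\<in>U. u - c \<le> v"
  shows "Inf U - c \<le> Inf V"
proof (rule cInf_greatest[OF assms(1)])
  fix v assume "v \<in> V"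
  then obtain u where "u \<in> U" "u - c \<le> v" using assms(3) by blast
  with cInf_lower[OF \<open>u \<in> U\<close> assms(2)] show "Inf U - c \<le> v" by simp
qed

text \<open>
  The value of a trajectory at the grid point common to two adjacent windows belongs to both, and no
  other value of the trajectory in either window is further away than the extremal rates allow over
  one grid step. So each value of one window has a partner in the other within that distance, and
  the distance passes to the suprema and infima.
\<close>

lemma jump_bounds:
  assumes T: "T > 0" and N: "N \<ge> 2" and X: "X \<noteq> {}"
    and rates: "bdd_above (rates T X)" "bdd_below (rates T X)"
    and windows: "\<And>t. t \<in> {0..T} \<Longrightarrow> bdd_above (window_values T N X t)"
      "\<And>t. t \<in> {0..T} \<Longrightarrow> bdd_below (window_values T N X t)"
    and j: "j \<in> {1..N-2}"
  defines "h \<equiv> T / (real N - 1)"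
  shows "upper_jump T N X j \<in> {min 0 (rmin T X * h)..max 0 (rmax T X * h)}"
    and "lower_jump T N X j \<in> {min 0 (rmin T X * h)..max 0 (rmax T X * h)}"
proof -
  define a where "a = grid T N j"
  have h: "h > 0" using T N by (simp add: h_def)
  have steps: "grid T N (j+1) = a + h" "grid T N (j+1+1) = a + h + h"
    using grid_Suc[of T N j] grid_Suc[of T N "j+1"] by (auto simp: a_def h_def)
  have dom: "a \<in> {0..T}" "a + h \<in> {0..T}" "a + h + h \<in> {0..T}"
    using grid_in_horizon[OF T N, of j] grid_in_horizon[OF T N, of "j+1"]
      grid_in_horizon[OF T N, of "j+1+1"] j N steps by (auto simp: a_def)
  define U where "U = window_values T N X a"
  define V where "V = window_values T N X (a + h)"
  have U: "U = {\<xi> \<tau> | \<xi> \<tau>. \<xi> \<in> X \<and> \<tau> \<in> {a..a + h}}"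
  proof -
    have "j \<in> {1..N-1}" using j by auto
    then show ?thesis using window_values_grid[OF T N, of j X] steps by (simp add: U_def a_def)
  qed
  have V: "V = {\<xi> \<tau> | \<xi> \<tau>. \<xi> \<in> X \<and> \<tau> \<in> {a + h..a + h + h}}"
  proof -
    have "j + 1 \<in> {1..N-1}" using j by auto
    then show ?thesis using window_values_grid[OF T N, of "j+1" X] steps by (simp add: V_def)
  qed
  have shared: "\<xi> (a + h) \<in> U \<and> \<xi> (a + h) \<in> V" if "\<xi> \<in> X" for \<xi>
    using that h unfolding U V by fastforce
  have ne: "U \<noteq> {}" "V \<noteq> {}" using X shared by blast+
  have bdd: "bdd_above U" "bdd_below U" "bdd_above V" "bdd_below V"
    using windows dom by (auto simp: U_def V_def)
  have right: "\<exists>u\<in>U. v - u \<le> max 0 (rmax T X * h) \<and> min 0 (rmin T X * h) \<le> v - u" if "v \<in> V" for v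
  proof -
    obtain \<xi> \<tau> where "\<xi> \<in> X" "v = \<xi> \<tau>" "\<tau> \<in> {a + h..a + h + h}" using \<open>v \<in> V\<close> V by auto
    then show ?thesis
      using increment_bounds[OF rates, of \<xi> "a + h" \<tau> h] dom shared by (intro bexI[of _ "\<xi> (a + h)"]) auto
  qed
  have left: "\<exists>v\<in>V. v - u \<le> max 0 (rmax T X * h) \<and> min 0 (rmin T X * h) \<le> v - u" if "u \<in> U" for u
  proof -
    obtain \<xi> \<tau> where "\<xi> \<in> X" "u = \<xi> \<tau>" "\<tau> \<in> {a..a + h}" using \<open>u \<in> U\<close> U by auto
    then show ?thesis
      using increment_bounds[OF rates, of \<xi> \<tau> "a + h" h] dom shared by (intro bexI[of _ "\<xi> (a + h)"]) auto
  qed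
  have "Sup V \<le> Sup U + max 0 (rmax T X * h)"
    using right by (intro Sup_le_Sup_plus ne bdd) force
  moreover have "Sup U \<le> Sup V + - min 0 (rmin T X * h)"
    using left by (intro Sup_le_Sup_plus ne bdd) force
  moreover have "Inf U - - min 0 (rmin T X * h) \<le> Inf V"
    using right by (intro Inf_minus_le_Inf ne bdd) force
  moreover have "Inf V - max 0 (rmax T X * h) \<le> Inf U"
    using left by (intro Inf_minus_le_Inf ne bdd) force
  moreover have "upper_jump T N X j = Sup V - Sup U" "lower_jump T N X j = Inf V - Inf U"
    by (simp_all only: upper_jump_def lower_jump_def window_sup_def window_inf_def steps U_def V_def
        a_def[symmetric])
  ultimately show "upper_jump T N X j \<in> {min 0 (rmin T X * h)..max 0 (rmax T X * h)}"
    and "lower_jump T N X j \<in> {min 0 (rmin T X * h)..max 0 (rmax T X * h)}" by auto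
qed

text \<open>
  Time needed to cover a rise \<open>c\<close> at rate \<open>r\<close>. If \<open>r\<close> is not positive, the bound on \<open>c\<close> leaves no
  rise at all; then the quotient is \<open>0\<close>, for \<open>r = 0\<close> by the convention \<open>x / 0 = 0\<close>.
\<close>

lemma jump_duration:
  fixes h r :: real
  assumes "0 \<le> c" "c \<le> max 0 (r * h)" "0 \<le> h"
  shows "c / r \<in> {0..h}"
proof (cases "r > 0")
  case True
  then have "c \<le> h * r" using assms by (simp add: mult.commute)
  with True assms show ?thesis by (simp add: pos_divide_le_eq)
next
  case False
  then have "r * h \<le> 0" using assms by (simp add: mult_nonpos_nonneg)
  with assms have "c = 0" by simp
  with assms show ?thesis by simp
qed

lemma bp_displacement:
  assumes T: "T > 0" and N: "N \<ge> 2" and X: "X \<noteq> {}"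
    and rates: "bdd_above (rates T X)" "bdd_below (rates T X)"
    and windows: "\<And>t. t \<in> {0..T} \<Longrightarrow> bdd_above (window_values T N X t)"
      "\<And>t. t \<in> {0..T} \<Longrightarrow> bdd_below (window_values T N X t)"
    and j: "j \<in> {1..N-2}"
  shows "upper_bp T N X j \<in> {grid T N j..grid T N (j+2)}"
    and "lower_bp T N X j \<in> {grid T N j..grid T N (j+2)}"
proof -
  define h where "h = T / (real N - 1)"
  have h: "h > 0" using T N by (simp add: h_def)
  have steps: "grid T N j = grid T N (j+1) - h" "grid T N (j+2) = grid T N (j+1) + h"
    using grid_Suc[of T N j] grid_Suc[of T N "j+1"] by (auto simp: h_def)
  \<comment> \<open>A fall at a negative rate is a rise of the negated trajectory.\<close>
  have dur: "(0 \<le> c \<longrightarrow> c / rmax T X \<in> {0..h}) \<and> (c < 0 \<longrightarrow> c / rmin T X \<in> {0..h})"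
    if "c \<in> {min 0 (rmin T X * h)..max 0 (rmax T X * h)}" for c
    using that h jump_duration[of c "rmax T X" h] jump_duration[of "-c" "- rmin T X" h] by auto
  show "upper_bp T N X j \<in> {grid T N j..grid T N (j+2)}"
    using dur[OF jump_bounds(1)[OF assms, folded h_def]] h
    unfolding upper_bp_def steps by auto
  show "lower_bp T N X j \<in> {grid T N j..grid T N (j+2)}"
    using dur[OF jump_bounds(2)[OF assms, folded h_def]] h
    unfolding lower_bp_def steps by auto
qed

lemma all_bps_subset_horizon:
  assumes T: "T > 0" and N: "N \<ge> 2" and X: "\<And>d. \<Xi> d \<noteq> {}"
    and rates: "\<And>d. bdd_above (rates T (\<Xi> d))" "\<And>d. bdd_below (rates T (\<Xi> d))"
    and windows: "\<And>d t. t \<in> {0..T} \<Longrightarrow> bdd_above (window_values T N (\<Xi> d) t)"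
      "\<And>d t. t \<in> {0..T} \<Longrightarrow> bdd_below (window_values T N (\<Xi> d) t)"
  shows "all_bps T N \<Xi> \<subseteq> {0..T}"
proof -
  have between: "x \<in> {0..T}" if "x \<in> {grid T N j..grid T N (j+2)}" "j \<in> {1..N-2}" for x j
  proof -
    have "j \<in> {1..N}" "j + 2 \<in> {1..N}" using that(2) by auto
    from this[THEN grid_in_horizon[OF T N]] that(1) show ?thesis by auto
  qed
  have "upper_bp T N (\<Xi> d) j \<in> {0..T}" "lower_bp T N (\<Xi> d) j \<in> {0..T}" if "j \<in> {1..N-2}" for d j
    using that bp_displacement[OF T N X rates windows] by (blast intro: between)+
  then show ?thesis
    using grid_in_horizon[OF T N] unfolding all_bps_def upper_bps_def lower_bps_def by blast
qed

section \<open>The partition by all breakpoints\<close>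

lemma finite_all_bps: "finite (all_bps T N \<Xi>)"
  by (simp add: all_bps_def upper_bps_def lower_bps_def)

lemma Tb_strict_mono: "strict_mono_on {1..num_bps T N \<Xi>} (Tb T N \<Xi>)"
proof (rule strict_mono_onI)
  fix r s assume "r \<in> {1..num_bps T N \<Xi>}" "s \<in> {1..num_bps T N \<Xi>}" "r < s"
  then show "Tb T N \<Xi> r < Tb T N \<Xi> s"
    unfolding Tb_def num_bps_def
    by (intro sorted_wrt_nth_less[OF strict_sorted_list_of_set]) auto
qed

lemma Tb_image: "Tb T N \<Xi> ` {1..num_bps T N \<Xi>} = all_bps T N \<Xi>"
proof -
  let ?l = "sorted_list_of_set (all_bps T N \<Xi>)"
  have "all_bps T N \<Xi> = set ?l" by (simp add: finite_all_bps)
  also have "\<dots> = (\<lambda>i. ?l ! i) ` {..<num_bps T N \<Xi>}"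
    by (auto simp: set_conv_nth num_bps_def)
  also have "{..<num_bps T N \<Xi>} = (\<lambda>j. j - 1) ` {1..num_bps T N \<Xi>}"
    by (auto simp: image_iff intro!: bexI[of _ "Suc _"])
  finally show ?thesis unfolding image_image Tb_def by (rule sym)
qed

lemma Tb_consecutive:
  assumes k: "k \<in> {1..num_bps T N \<Xi> - 1}"
  shows "Tb T N \<Xi> k < Tb T N \<Xi> (k+1)"
    and "all_bps T N \<Xi> \<inter> {Tb T N \<Xi> k<..<Tb T N \<Xi> (k+1)} = {}"
proof -
  note mono = Tb_strict_mono[of T N \<Xi>]
  have le: "1 \<le> k" "k \<le> num_bps T N \<Xi>" "k + 1 \<le> num_bps T N \<Xi>" using k by auto
  show "Tb T N \<Xi> k < Tb T N \<Xi> (k+1)"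
    using strict_mono_onD[OF mono, of k "k+1"] le by auto
  have "Tb T N \<Xi> i \<notin> {Tb T N \<Xi> k<..<Tb T N \<Xi> (k+1)}" if i: "i \<in> {1..num_bps T N \<Xi>}" for i
    using strict_mono_on_leD[OF mono, of i k] strict_mono_on_leD[OF mono, of "k+1" i] i le
    by (cases "i \<le> k") auto
  then show "all_bps T N \<Xi> \<inter> {Tb T N \<Xi> k<..<Tb T N \<Xi> (k+1)} = {}"
    unfolding Tb_image[symmetric] by blast
qed

lemma horizon_ends_in_bps:
  assumes "N \<ge> 2"
  shows "0 \<in> upper_bps T N X" "T \<in> upper_bps T N X" "0 \<in> lower_bps T N X" "T \<in> lower_bps T N X"
proof -
  have "1 \<in> {1..N}" "N \<in> {1..N}" using assms by auto
  from this[THEN imageI[where f = "grid T N"]]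
  have "0 \<in> grid T N ` {1..N}" "T \<in> grid T N ` {1..N}" by (simp_all only: grid_ends[OF assms])
  then show "0 \<in> upper_bps T N X" "T \<in> upper_bps T N X" "0 \<in> lower_bps T N X" "T \<in> lower_bps T N X"
    by (auto simp: upper_bps_def lower_bps_def)
qed

lemma Tb_ends:
  assumes T: "T > 0" and N: "N \<ge> 2" and sub: "all_bps T N \<Xi> \<subseteq> {0..T}"
  shows "num_bps T N \<Xi> \<ge> 2" "Tb T N \<Xi> 1 = 0" "Tb T N \<Xi> (num_bps T N \<Xi>) = T"
proof -
  let ?M = "num_bps T N \<Xi>"
  note mono = Tb_strict_mono[of T N \<Xi>]
  have "0 \<in> all_bps T N \<Xi>" "T \<in> all_bps T N \<Xi>"
    using horizon_ends_in_bps[OF N] by (auto simp: all_bps_def)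
  then obtain i j where i: "i \<in> {1..?M}" "Tb T N \<Xi> i = 0" and j: "j \<in> {1..?M}" "Tb T N \<Xi> j = T"
    unfolding Tb_image[symmetric] by fastforce
  have "i \<noteq> j" using i j T by auto
  then show "?M \<ge> 2" using i j by auto
  then have "1 \<in> {1..?M}" "?M \<in> {1..?M}" by auto
  then have "Tb T N \<Xi> 1 \<in> {0..T}" "Tb T N \<Xi> ?M \<in> {0..T}"
    using sub unfolding Tb_image[symmetric] by blast+
  then show "Tb T N \<Xi> 1 = 0" "Tb T N \<Xi> ?M = T"
    using strict_mono_on_leD[OF mono, of 1 i] strict_mono_on_leD[OF mono, of j ?M] i j by auto
qed

text \<open>
  At the right end of the horizon the prescribed value of \<open>\<gamma>\<close> agrees with the quotient formula, so the
  decision rule interpolates linearly on every segment, closed on both sides.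
\<close>

lemma convex_position_in_segment:
  assumes T: "T > 0" and N: "N \<ge> 2" and sub: "all_bps T N \<Xi> \<subseteq> {0..T}" and t: "t \<in> {0..T}"
  defines "k \<equiv> k_index T N \<Xi> t"
  shows "k \<in> {1..num_bps T N \<Xi> - 1}" "\<gamma> T N \<Xi> t \<in> {0..1}"
    and "t = (1 - \<gamma> T N \<Xi> t) * Tb T N \<Xi> k + \<gamma> T N \<Xi> t * Tb T N \<Xi> (k+1)"
proof -
  note ends = Tb_ends[OF T N sub]
  note bracket = seg_index_bracket[OF Tb_strict_mono ends(1), of t, unfolded ends(2,3), OF t,
      folded k_index_def, folded k_def]
  show k: "k \<in> {1..num_bps T N \<Xi> - 1}" by (fact bracket(1))
  let ?a = "Tb T N \<Xi> k" and ?b = "Tb T N \<Xi> (k+1)"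
  have ab: "?a < ?b" using Tb_consecutive(1)[OF k] .
  have g: "\<gamma> T N \<Xi> t = (t - ?a) / (?b - ?a)"
  proof (cases "t = T")
    case True
    then have "k + 1 = num_bps T N \<Xi>"
      using ends by (simp add: k_def k_index_def seg_index_def)
    with True ends(3) ab show ?thesis by (simp add: \<gamma>_def)
  qed (simp add: \<gamma>_def k_def)
  show "\<gamma> T N \<Xi> t \<in> {0..1}" using bracket ab by (simp add: g)
  have "\<gamma> T N \<Xi> t * (?b - ?a) = t - ?a" using ab by (simp add: g)
  then show "t = (1 - \<gamma> T N \<Xi> t) * ?a + \<gamma> T N \<Xi> t * ?b"
    by (simp add: algebra_simps)
qed

text \<open>
  A breakpoint starts its own segment, with weight \<open>0\<close>, except the last one, which closes the last
  segment and is reached with weight \<open>1\<close>.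
\<close>

lemma x_hat_at_breakpoint:
  assumes T: "T > 0" and N: "N \<ge> 2" and sub: "all_bps T N \<Xi> \<subseteq> {0..T}"
    and j: "j \<in> {1..num_bps T N \<Xi>}"
  shows "x_hat T N \<Xi> \<alpha> \<beta> \<xi> (Tb T N \<Xi> j) = \<alpha> *v \<xi> (Tb T N \<Xi> j) + \<beta> j"
proof (cases "j = num_bps T N \<Xi>")
  case True
  with Tb_ends[OF T N sub] show ?thesis
    by (simp add: x_hat_def k_index_def seg_index_def \<gamma>_def)
next
  case False
  with j have j': "j \<in> {1..num_bps T N \<Xi> - 1}" and less: "j < num_bps T N \<Xi>" by auto
  have "k_index T N \<Xi> (Tb T N \<Xi> j) = j"
    unfolding k_index_def using Tb_consecutive(1)[OF j'] by (intro seg_index_eq Tb_strict_mono j') auto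
  moreover have "Tb T N \<Xi> j \<noteq> T"
    using strict_mono_onD[OF Tb_strict_mono, of j T N \<Xi> "num_bps T N \<Xi>"] Tb_ends(3)[OF T N sub] j less
    by auto
  ultimately show ?thesis by (simp add: x_hat_def \<gamma>_def)
qed

section \<open>Affine functions on segments\<close>

text \<open>
  Two consecutive points of a finer set of breakpoints lie between two consecutive points of the
  coarser one: the last coarse point before the segment and the first one after it.
\<close>

lemma affine_on_between_refinement:
  fixes f :: "real \<Rightarrow> real"
  assumes f: "affine_between P f" and "finite P" "P \<subseteq> Q"
    and ab: "a < b" "Q \<inter> {a<..<b} = {}"
    and cover: "\<exists>p\<in>P. p \<le> a" "\<exists>p\<in>P. b \<le> p"
    and u: "u \<in> {0..1}"
  shows "f ((1 - u) * a + u * b) = (1 - u) * f a + u * f b"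
proof -
  define a' where "a' = Max {p\<in>P. p \<le> a}"
  define b' where "b' = Min {p\<in>P. b \<le> p}"
  have a': "a' \<in> P" "a' \<le> a" "\<And>p. p \<in> P \<Longrightarrow> p \<le> a \<Longrightarrow> p \<le> a'"
  proof -
    have "finite {p\<in>P. p \<le> a}" "{p\<in>P. p \<le> a} \<noteq> {}" using \<open>finite P\<close> cover by auto
    from Max_in[OF this] Max_ge[OF this(1)]
    show "a' \<in> P" "a' \<le> a" "\<And>p. p \<in> P \<Longrightarrow> p \<le> a \<Longrightarrow> p \<le> a'" by (auto simp: a'_def)
  qed
  have b': "b' \<in> P" "b \<le> b'" "\<And>p. p \<in> P \<Longrightarrow> b \<le> p \<Longrightarrow> b' \<le> p"
  proof -
    have "finite {p\<in>P. b \<le> p}" "{p\<in>P. b \<le> p} \<noteq> {}" using \<open>finite P\<close> cover by auto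
    from Min_in[OF this] Min_le[OF this(1)]
    show "b' \<in> P" "b \<le> b'" "\<And>p. p \<in> P \<Longrightarrow> b \<le> p \<Longrightarrow> b' \<le> p" by (auto simp: b'_def)
  qed
  have "P \<inter> {a'<..<b'} = {}"
  proof (rule ccontr)
    assume "P \<inter> {a'<..<b'} \<noteq> {}"
    then obtain p where p: "p \<in> P" "a' < p" "p < b'" by auto
    with a'(3)[of p] b'(3)[of p] have "p \<in> Q \<inter> {a<..<b}" using \<open>P \<subseteq> Q\<close> by force
    with ab show False by blast
  qed
  moreover have "a' < b'" using a' b' ab by linarith
  ultimately obtain m c where mc: "\<And>t. t \<in> {a'..b'} \<Longrightarrow> f t = m * t + c"
    using f a'(1) b'(1) unfolding affine_between_def by blast
  have "(1 - u) * a + u * b \<in> {a..b}"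
  proof -
    have "0 \<le> u * (b - a)" "0 \<le> (1 - u) * (b - a)" using u ab by auto
    then show ?thesis by (simp add: algebra_simps)
  qed
  then show ?thesis
    using a'(2) b'(2) ab by (simp add: mc) (simp add: algebra_simps)
qed

lemma envelope_affine_on_segment:
  assumes T: "T > 0" and N: "N \<ge> 2" and sub: "all_bps T N \<Xi> \<subseteq> {0..T}"
    and w: "is_upper_envelope T N (\<Xi> d) w \<or> is_lower_envelope T N (\<Xi> d) w"
    and t: "t \<in> {0..T}"
  shows "w t = (1 - \<gamma> T N \<Xi> t) * w (Tb T N \<Xi> (k_index T N \<Xi> t))
    + \<gamma> T N \<Xi> t * w (Tb T N \<Xi> (k_index T N \<Xi> t + 1))"
proof -
  define k where "k = k_index T N \<Xi> t"
  note pos = convex_position_in_segment[OF T N sub t, folded k_def]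
  have "k \<in> {1..num_bps T N \<Xi>}" "k + 1 \<in> {1..num_bps T N \<Xi>}" using pos(1) by auto
  then have dom: "Tb T N \<Xi> k \<in> {0..T}" "Tb T N \<Xi> (k+1) \<in> {0..T}"
    using sub unfolding Tb_image[symmetric] by blast+
  obtain P where P: "affine_between P w" "finite P" "P \<subseteq> all_bps T N \<Xi>" "0 \<in> P" "T \<in> P"
  proof (cases "is_upper_envelope T N (\<Xi> d) w")
    case True
    then show thesis using horizon_ends_in_bps[OF N, where X = "\<Xi> d"]
      by (intro that[of "upper_bps T N (\<Xi> d)"])
        (auto simp: is_upper_envelope_def all_bps_def upper_bps_def)
  next
    case False
    then show thesis using w horizon_ends_in_bps[OF N, where X = "\<Xi> d"]
      by (intro that[of "lower_bps T N (\<Xi> d)"])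
        (auto simp: is_lower_envelope_def all_bps_def lower_bps_def)
  qed
  have "w ((1 - \<gamma> T N \<Xi> t) * Tb T N \<Xi> k + \<gamma> T N \<Xi> t * Tb T N \<Xi> (k+1))
    = (1 - \<gamma> T N \<Xi> t) * w (Tb T N \<Xi> k) + \<gamma> T N \<Xi> t * w (Tb T N \<Xi> (k+1))"
    using P dom Tb_consecutive[OF pos(1)] pos(2)
    by (intro affine_on_between_refinement[OF P(1-3)]) auto
  then show ?thesis using pos(3) by (simp add: k_def)
qed

section \<open>Robust constraints\<close>

lemma constraint_lhs_x_hat:
  fixes A :: "real^'g^'r" and B :: "real^'d^'r"
  shows "A *v x_hat T N \<Xi> \<alpha> \<beta> \<xi> t + B *v \<xi> t = (A ** \<alpha> + B) *v \<xi> t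
    + ((1 - \<gamma> T N \<Xi> t) *\<^sub>R (A *v \<beta> (k_index T N \<Xi> t)) + \<gamma> T N \<Xi> t *\<^sub>R (A *v \<beta> (k_index T N \<Xi> t + 1)))"
  by (simp add: x_hat_def matrix_vector_right_distrib matrix_vector_mult_add_rdistrib
      matrix_vector_mul_assoc matrix_vector_mult_scaleR algebra_simps)

text \<open>
  The signs of the coefficients in a row select a vertex of the box. The same selector \<open>s\<close> is the
  worst one for every box, so the worst vertex of the intermediate box is the convex combination of
  the worst vertices of the two end boxes.
\<close>

lemma row_bound_by_vertices:
  fixes C :: "real^'d^'r" and x lo hi lo0 hi0 lo1 hi1 :: "real^'d" and b0 b1 a :: "real^'r"
  assumes x: "lo \<le> x" "x \<le> hi" and u: "u \<in> {0..1}"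
    and lo: "lo = (1 - u) *\<^sub>R lo0 + u *\<^sub>R lo1" and hi: "hi = (1 - u) *\<^sub>R hi0 + u *\<^sub>R hi1"
    and vertex0: "\<And>s. \<forall>d. s $ d \<in> {0, 1} \<Longrightarrow> C *v (lo0 + s * (hi0 - lo0)) + b0 \<le> a"
    and vertex1: "\<And>s. \<forall>d. s $ d \<in> {0, 1} \<Longrightarrow> C *v (lo1 + s * (hi1 - lo1)) + b1 \<le> a"
  shows "C *v x + ((1 - u) *\<^sub>R b0 + u *\<^sub>R b1) \<le> a"
  unfolding less_eq_vec_def
proof
  fix r
  define s :: "real^'d" where "s = (\<chi> d. if 0 \<le> C $ r $ d then 1 else 0)"
  have s: "\<forall>d. s $ d \<in> {0, 1}" by (simp add: s_def)
  have "C $ r $ d * x $ d \<le> C $ r $ d * (lo + s * (hi - lo)) $ d" for d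
    using x by (auto simp: s_def less_eq_vec_def intro: mult_left_mono mult_left_mono_neg)
  then have "(C *v x) $ r \<le> (C *v (lo + s * (hi - lo))) $ r"
    by (simp add: matrix_vector_mult_def sum_mono)
  also have "lo + s * (hi - lo) =
      (1 - u) *\<^sub>R (lo0 + s * (hi0 - lo0)) + u *\<^sub>R (lo1 + s * (hi1 - lo1))"
    by (simp add: vec_eq_iff lo hi algebra_simps)
  finally have "(C *v x) $ r + (1 - u) * b0 $ r + u * b1 $ r
      \<le> (1 - u) * ((C *v (lo0 + s * (hi0 - lo0)) + b0) $ r)
        + u * ((C *v (lo1 + s * (hi1 - lo1)) + b1) $ r)"
    by (simp add: matrix_vector_right_distrib matrix_vector_mult_scaleR algebra_simps)
  also have "\<dots> \<le> (1 - u) * a $ r + u * a $ r"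
    using vertex0[OF s] vertex1[OF s] u
    by (intro add_mono mult_left_mono) (auto simp: less_eq_vec_def)
  finally show "(C *v x + ((1 - u) *\<^sub>R b0 + u *\<^sub>R b1)) $ r \<le> a $ r"
    by (simp add: algebra_simps)
qed

theorem proposition2:
  fixes T :: real and N :: nat
    and Xmax Xmin :: "real^'g" and Fmax :: "real^'l"
    and Fg :: "real^'g^'l" and Fd :: "real^'d^'l"
    and \<Xi> :: "'d \<Rightarrow> (real \<Rightarrow> real) set"
    and \<omega>max \<omega>min :: "real \<Rightarrow> real^'d"
    and \<sigma> :: "nat \<Rightarrow> real^'d" and H :: "nat \<Rightarrow> real^'d"
    and \<alpha> :: "real^'d^'g" and \<beta> :: "nat \<Rightarrow> real^'g"
  assumes "T > 0" and "N \<ge> 2"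
    and "0 \<le> Xmax" and "0 \<le> Xmin" and "0 \<le> Fmax"
    and two_elements: "\<And>d. \<exists>\<xi>\<in>\<Xi> d. \<exists>\<xi>'\<in>\<Xi> d. \<exists>t\<in>{0..T}. \<xi> t \<noteq> \<xi>' t"
    and finite_rates: "\<And>d. bdd_above (rates T (\<Xi> d))" "\<And>d. bdd_below (rates T (\<Xi> d))"
    and finite_windows:
      "\<And>d t. t \<in> {0..T} \<Longrightarrow> bdd_above (window_values T N (\<Xi> d) t)"
      "\<And>d t. t \<in> {0..T} \<Longrightarrow> bdd_below (window_values T N (\<Xi> d) t)"
    and envelopes:
      "\<And>d. is_upper_envelope T N (\<Xi> d) (\<lambda>t. \<omega>max t $ d)"
      "\<And>d. is_lower_envelope T N (\<Xi> d) (\<lambda>t. \<omega>min t $ d)"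
    and envelopes_in_Omega:
      "\<And>d. (\<lambda>t. \<omega>max t $ d) \<in> Omega_comp T N (\<Xi> d)"
      "\<And>d. (\<lambda>t. \<omega>min t $ d) \<in> Omega_comp T N (\<Xi> d)"
    and envelopes_extremal:
      "\<And>d \<xi> t. \<xi> \<in> Omega_comp T N (\<Xi> d) \<Longrightarrow> t \<in> {0..T} \<Longrightarrow>
         \<omega>min t $ d \<le> \<xi> t \<and> \<xi> t \<le> \<omega>max t $ d"
    and sections_of_Omega:
      "\<And>d t. t \<in> {0..T} \<Longrightarrow>
         {\<xi> t | \<xi>. \<xi> \<in> Omega_comp T N (\<Xi> d)} = {\<omega>min t $ d..\<omega>max t $ d}"
    and enumeration: "bij_betw \<sigma> {1..2 ^ CARD('d)} {s. \<forall>d. s $ d \<in> {0, 1}}"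
    and H: "\<And>j. j \<in> {1..num_bps T N \<Xi>} \<Longrightarrow>
         H j = \<omega>max (Tb T N \<Xi> j) - \<omega>min (Tb T N \<Xi> j)"
  shows "(\<forall>\<xi>\<in>Omega T N \<Xi>. \<forall>t\<in>{0..T}.
            con_A Fg *v x_hat T N \<Xi> \<alpha> \<beta> \<xi> t + con_B Fd *v \<xi> t \<le> con_a Xmax Xmin Fmax)
     \<longleftrightarrow> (\<forall>j\<in>{1..num_bps T N \<Xi>}. \<forall>l\<in>{1..2 ^ CARD('d)}.
            (con_A Fg ** \<alpha> + con_B Fd) *v (\<omega>min (Tb T N \<Xi> j) + \<sigma> l * H j)
              + con_A Fg *v \<beta> j \<le> con_a Xmax Xmin Fmax)"
proof -
  let ?M = "num_bps T N \<Xi>" and ?Tb = "Tb T N \<Xi>"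
  let ?C = "con_A Fg ** \<alpha> + con_B Fd" and ?A = "con_A Fg" and ?a = "con_a Xmax Xmin Fmax"
  have "\<Xi> d \<noteq> {}" for d using two_elements by blast
  from all_bps_subset_horizon[OF \<open>T > 0\<close> \<open>N \<ge> 2\<close> this finite_rates finite_windows]
  have sub: "all_bps T N \<Xi> \<subseteq> {0..T}" .
  note setting = \<open>T > 0\<close> \<open>N \<ge> 2\<close> sub
  have Tb_dom: "?Tb j \<in> {0..T}" if "j \<in> {1..?M}" for j
    using that sub unfolding Tb_image[symmetric] by blast
  show ?thesis
  proof (intro iffI ballI)
    fix j l :: nat assume robust: "\<forall>\<xi>\<in>Omega T N \<Xi>. \<forall>t\<in>{0..T}.
        ?A *v x_hat T N \<Xi> \<alpha> \<beta> \<xi> t + con_B Fd *v \<xi> t \<le> ?a"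
      and j: "j \<in> {1..?M}" and l: "l \<in> {1..2 ^ CARD('d)}"
    have \<sigma>: "\<sigma> l $ d \<in> {0, 1}" for d
      using bij_betwE[OF enumeration] l by blast
    \<comment> \<open>In each coordinate this trajectory is one of the two envelopes, as \<open>\<sigma> l\<close> prescribes.\<close>
    define \<xi> where "\<xi> = (\<lambda>t. \<omega>min t + \<sigma> l * (\<omega>max t - \<omega>min t))"
    have "(\<lambda>t. \<xi> t $ d) = (if \<sigma> l $ d = 1 then (\<lambda>t. \<omega>max t $ d) else (\<lambda>t. \<omega>min t $ d))" for d
      using \<sigma>[of d] by (auto simp: \<xi>_def)
    then have "\<xi> \<in> Omega T N \<Xi>"
      using envelopes_in_Omega by (simp add: Omega_def)
    then have "?A *v x_hat T N \<Xi> \<alpha> \<beta> \<xi> (?Tb j) + con_B Fd *v \<xi> (?Tb j) \<le> ?a"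
      using robust Tb_dom[OF j] by blast
    moreover have "?A *v x_hat T N \<Xi> \<alpha> \<beta> \<xi> (?Tb j) + con_B Fd *v \<xi> (?Tb j)
        = ?C *v \<xi> (?Tb j) + ?A *v \<beta> j"
      unfolding x_hat_at_breakpoint[OF setting j]
      by (simp add: matrix_vector_right_distrib matrix_vector_mult_add_rdistrib
          matrix_vector_mul_assoc algebra_simps)
    ultimately show "?C *v (\<omega>min (?Tb j) + \<sigma> l * H j) + ?A *v \<beta> j \<le> ?a"
      by (simp add: \<xi>_def H[OF j])
  next
    fix \<xi> t assume vertices: "\<forall>j\<in>{1..?M}. \<forall>l\<in>{1..2 ^ CARD('d)}.
        ?C *v (\<omega>min (?Tb j) + \<sigma> l * H j) + ?A *v \<beta> j \<le> ?a"
      and \<xi>: "\<xi> \<in> Omega T N \<Xi>" and t: "t \<in> {0..T}"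
    have vertex: "?C *v (\<omega>min (?Tb j) + s * (\<omega>max (?Tb j) - \<omega>min (?Tb j))) + ?A *v \<beta> j \<le> ?a"
      if j: "j \<in> {1..?M}" and s: "\<forall>d. s $ d \<in> {0, 1}" for j s
    proof -
      have "s \<in> \<sigma> ` {1..2 ^ CARD('d)}"
        using s bij_betw_imp_surj_on[OF enumeration] by simp
      then obtain l where "l \<in> {1..2 ^ CARD('d)}" "s = \<sigma> l" by blast
      then show ?thesis using vertices j H[OF j] by metis
    qed
    define k where "k = k_index T N \<Xi> t"
    note pos = convex_position_in_segment[OF setting t, folded k_def]
    have k: "k \<in> {1..?M}" "k + 1 \<in> {1..?M}" using pos(1) by auto
    have box: "\<omega>min t \<le> \<xi> t" "\<xi> t \<le> \<omega>max t"
      using \<xi> envelopes_extremal[OF _ t] by (auto simp: Omega_def less_eq_vec_def)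
    have "\<omega>min t = (1 - \<gamma> T N \<Xi> t) *\<^sub>R \<omega>min (?Tb k) + \<gamma> T N \<Xi> t *\<^sub>R \<omega>min (?Tb (k+1))"
      "\<omega>max t = (1 - \<gamma> T N \<Xi> t) *\<^sub>R \<omega>max (?Tb k) + \<gamma> T N \<Xi> t *\<^sub>R \<omega>max (?Tb (k+1))"
      using envelope_affine_on_segment[OF setting disjI2 t, OF envelopes(2)]
        envelope_affine_on_segment[OF setting disjI1 t, OF envelopes(1)]
      by (simp_all add: vec_eq_iff k_def)
    from row_bound_by_vertices[OF box pos(2) this vertex[OF k(1)] vertex[OF k(2)]]
    show "?A *v x_hat T N \<Xi> \<alpha> \<beta> \<xi> t + con_B Fd *v \<xi> t \<le> ?a"
      unfolding constraint_lhs_x_hat k_def[symmetric] by simp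
  qed
qed

end
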